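(* For every composition $I$ and every prime $p$, $S_I(p-1)\equiv -S_{I^*}(p-1) \pmod p$.
   Context: A composition is a nonempty finite sequence $I=(i_1,\dots,i_k)$ of positive integers, with weight $|I|=i_1+\cdots+i_k$. Compositions of weight $m$ are in bijection with subsets of $\{1,2,\dots,m-1\}$ via $(i_1,\dots,i_k)\mapsto\{i_1,\,i_1+i_2,\dots,\,i_1+\cdots+i_{k-1}\}$. The composition $I^*$ is the composition of weight $|I|$ whose associated subset is the complement in $\{1,\dots,|I|-1\}$ of the subset associated with $I$; e.g. $(1,1,2)^*=(3,1)$. For a composition $I=(i_1,\dots,i_k)$ and an integer $n\ge 0$ put $$S_I(n)=\sum_{n\ge n_1\ge n_2\ge\cdots\ge n_k\ge 1}\frac{1}{n_1^{i_1}\cdots n_k^{i_k}}.$$ For $p$ prime the rational number $S_I(p-1)$ has denominator prime to $p$, and is regarded as an element of the field $\mathbf{Z}/p\mathbf{Z}$; congruences mod $p$ are understood in this sense. *)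

theory Defs
  imports Complex_Main "HOL-Computational_Algebra.Primes" "HOL-Number_Theory.Modular_Inverse"
begin

definition composition :: "nat list \<Rightarrow> bool" where
  "composition I \<longleftrightarrow> I \<noteq> [] \<and> (\<forall>i\<in>set I. 0 < i)"

definition weight :: "nat list \<Rightarrow> nat" where
  "weight I = sum_list I"

definition subset_of_comp :: "nat list \<Rightarrow> nat set" where
  "subset_of_comp I = {sum_list (take j I) | j. 1 \<le> j \<and> j < length I}"

text \<open>For a composition \<open>I\<close>, existence and uniqueness of the list described below are
  proved in \<open>dual_comp_ex1\<close>; no claim is made for lists that are not compositions.\<close>

definition dual_comp :: "nat list \<Rightarrow> nat list" where
  "dual_comp I = (THE J. composition J \<and> weight J = weight I \<and>
     subset_of_comp J = {1..<weight I} - subset_of_comp I)"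

text \<open>A tuple $n \ge n_1 \ge \dots \ge n_k \ge 1$ is the list \<open>ns\<close> with entries
  $n_{j+1} =$ \<open>ns ! j\<close>; all its entries lie in \<open>{1..n}\<close>, so the sum is finite.\<close>

definition S :: "nat list \<Rightarrow> nat \<Rightarrow> rat" where
  "S I n = (\<Sum>ns | length ns = length I \<and> set ns \<subseteq> {1..n} \<and> sorted_wrt (\<ge>) ns.
     1 / (\<Prod>j<length I. of_nat (ns ! j) ^ (I ! j)))"

text \<open>\<open>quotient_of\<close> returns numerator and denominator in lowest terms. The image in
  $\mathbf{Z}/p\mathbf{Z}$ of a rational with denominator prime to $p$ is represented by an
  integer in \<open>{0..<p}\<close>.\<close>

definition rat_integral_at :: "nat \<Rightarrow> rat \<Rightarrow> bool" where
  "rat_integral_at p x \<longleftrightarrow> coprime (snd (quotient_of x)) (int p)"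

definition rat_residue :: "nat \<Rightarrow> rat \<Rightarrow> int" where
  "rat_residue p x =
     (fst (quotient_of x) * modular_inverse (int p) (snd (quotient_of x))) mod int p"

definition rat_cong :: "rat \<Rightarrow> rat \<Rightarrow> nat \<Rightarrow> bool" where
  "rat_cong x y p \<longleftrightarrow> rat_integral_at p x \<and> rat_integral_at p y \<and> rat_residue p x = rat_residue p y"

lemma subset_of_comp_Cons:
  "subset_of_comp (i # I) = (if I = [] then {} else insert i ((+) i ` subset_of_comp I))"
proof (cases "I = []")
  case False
  have "subset_of_comp (i # I) = (\<lambda>j. sum_list (take j (i # I))) ` {1..length I}"
    by (auto simp: subset_of_comp_def less_Suc_eq_le)
  also have "{1..length I} = insert 1 (Suc ` {1..<length I})"
    using False by (auto simp: image_Suc_atLeastLessThan Suc_le_eq)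
  also have "(\<lambda>j. sum_list (take j (i # I))) ` insert 1 (Suc ` {1..<length I})
      = insert i ((+) i ` subset_of_comp I)"
    unfolding image_insert image_image
    by (auto simp: subset_of_comp_def image_iff)
  finally show ?thesis using False by simp
qed (auto simp: subset_of_comp_def)

lemma weight_pos: "composition I \<Longrightarrow> 0 < weight I"
  by (cases I) (auto simp: composition_def weight_def)

lemma composition_Cons:
  "composition (i # I) \<longleftrightarrow> 0 < i \<and> (I = [] \<or> composition I)"
  by (auto simp: composition_def)

lemma subset_of_comp_subset: "composition I \<Longrightarrow> subset_of_comp I \<subseteq> {1..<weight I}"
proof (induction I)
  case (Cons i I)
  show ?case
  proof (cases "I = []")
    case False
    with Cons.prems have "0 < i" "composition I" by (auto simp: composition_Cons)
    with Cons.IH weight_pos[of I] False show ?thesis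
      by (fastforce simp: subset_of_comp_Cons weight_def)
  qed (simp add: subset_of_comp_Cons)
qed (simp add: composition_def)

lemma subset_of_comp_inj:
  "composition I \<Longrightarrow> composition J \<Longrightarrow> weight I = weight J
    \<Longrightarrow> subset_of_comp I = subset_of_comp J \<Longrightarrow> I = J"
proof (induction I arbitrary: J)
  case (Cons i I)
  obtain j J' where J: "J = j # J'" using Cons.prems by (cases J) (auto simp: composition_def)
  show ?case
  proof (cases "I = [] \<or> J' = []")
    case True
    with Cons.prems J show ?thesis
      by (auto simp: subset_of_comp_Cons weight_def split: if_splits)
  next
    case False
    have cI: "composition I" "composition J'"
      using Cons.prems False unfolding J by (auto simp: composition_Cons)
    have eq: "insert i ((+) i ` subset_of_comp I) = insert j ((+) j ` subset_of_comp J')"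
      using Cons.prems(4) False unfolding J by (simp add: subset_of_comp_Cons)
    have pos: "0 \<notin> subset_of_comp I" "0 \<notin> subset_of_comp J'"
      using subset_of_comp_subset[OF cI(1)] subset_of_comp_subset[OF cI(2)] by auto
    have "i \<in> insert j ((+) j ` subset_of_comp J')" using eq by blast
    then have "j \<le> i" by auto
    have "j \<in> insert i ((+) i ` subset_of_comp I)" using eq by blast
    then have "i = j" using \<open>j \<le> i\<close> by auto
    have "i \<notin> (+) i ` subset_of_comp I" "i \<notin> (+) i ` subset_of_comp J'"
      using pos by auto
    with \<open>i = j\<close> have "(+) i ` subset_of_comp I = (+) i ` subset_of_comp J'"
      using eq by (metis insert_ident)
    then have "subset_of_comp I = subset_of_comp J'"
      by (simp add: inj_image_eq_iff)
    with Cons.IH[OF cI] Cons.prems(3) \<open>i = j\<close> J show ?thesis by (simp add: weight_def)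
  qed
qed (simp add: composition_def)

lemma subset_of_comp_surj:
  "0 < m \<Longrightarrow> A \<subseteq> {1..<m} \<Longrightarrow> \<exists>I. composition I \<and> weight I = m \<and> subset_of_comp I = A"
proof (induction m arbitrary: A rule: less_induct)
  case (less m)
  show ?case
  proof (cases "A = {}")
    case True
    then show ?thesis using less.prems
      by (intro exI[of _ "[m]"]) (simp add: composition_def weight_def subset_of_comp_Cons)
  next
    case False
    have fin: "finite A" using less.prems finite_subset by blast
    define i where "i = Min A"
    have iA: "i \<in> A" and le: "\<And>a. a \<in> A \<Longrightarrow> i \<le> a"
      using fin False by (auto simp: i_def)
    define B where "B = (\<lambda>a. a - i) ` (A - {i})"
    have i: "0 < i" "i < m" using iA less.prems by auto
    have "B \<subseteq> {1..<m - i}"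
    proof
      fix b assume "b \<in> B"
      then obtain a where a: "a \<in> A" "a \<noteq> i" "b = a - i" by (auto simp: B_def)
      with le[of a] less.prems show "b \<in> {1..<m - i}" by force
    qed
    then obtain I where I: "composition I" "weight I = m - i" "subset_of_comp I = B"
      using less.IH[of "m - i" B] i by auto
    have "(+) i ` B = A - {i}"
      unfolding B_def image_image using le by (force simp: image_iff)
    moreover have "I \<noteq> []" using I(1) by (simp add: composition_def)
    ultimately have "subset_of_comp (i # I) = A"
      using iA I(3) by (auto simp: subset_of_comp_Cons)
    moreover have "composition (i # I)" "weight (i # I) = m"
      using I i by (auto simp: composition_Cons weight_def)
    ultimately show ?thesis by blast
  qed
qed

lemma dual_comp_ex1:
  assumes "composition I"
  shows "\<exists>!J. composition J \<and> weight J = weight I \<and>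
           subset_of_comp J = {1..<weight I} - subset_of_comp I"
  using subset_of_comp_surj[OF weight_pos[OF assms], of "{1..<weight I} - subset_of_comp I"]
  by (metis Diff_subset subset_of_comp_inj)

lemma dual_comp_eqI:
  assumes "composition I" "composition J" "weight J = weight I"
    "subset_of_comp J = {1..<weight I} - subset_of_comp I"
  shows "dual_comp I = J"
  unfolding dual_comp_def using dual_comp_ex1[OF assms(1)] assms by (intro the1_equality) auto

lemma dual_comp_112: "dual_comp [1, 1, 2] = [3, 1]"
proof (rule dual_comp_eqI)
  have "{1..<4} = {1, 2, 3::nat}" by auto
  then show "subset_of_comp [3, 1] = {1..<weight [1, 1, 2]} - subset_of_comp [1, 1, 2]"
    by (auto simp: subset_of_comp_Cons weight_def)
qed (auto simp: composition_def weight_def)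

lemma finite_S_index:
  fixes k n :: nat
  shows "finite {ns. length ns = k \<and> set ns \<subseteq> {1..n} \<and> sorted_wrt (\<ge>) ns}"
  by (rule finite_subset[OF _ finite_lists_length_eq[OF finite_atLeastAtMost[of 1 n], of k]]) auto

lemma rat_cong_iff:
  assumes "rat_integral_at p x" "rat_integral_at p y"
    and "quotient_of x = (a, b)" "quotient_of y = (c, d)"
  shows "rat_cong x y p \<longleftrightarrow> [a * d = c * b] (mod int p)"
proof -
  let ?b = "modular_inverse (int p) b" and ?d = "modular_inverse (int p) d"
  have co: "coprime b (int p)" "coprime d (int p)"
    using assms by (simp_all add: rat_integral_at_def)
  have b: "[b * ?b = 1] (mod int p)" and d: "[d * ?d = 1] (mod int p)"
    using co by (auto intro: cong_modular_inverse1)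
  have "rat_cong x y p \<longleftrightarrow> [a * ?b = c * ?d] (mod int p)"
    using assms by (simp add: rat_cong_def rat_residue_def cong_def)
  also have "\<dots> \<longleftrightarrow> [(a * ?b) * (b * d) = (c * ?d) * (b * d)] (mod int p)"
    using co by (subst cong_mult_rcancel) auto
  also have "(a * ?b) * (b * d) = (b * ?b) * (a * d)" by simp
  also have "(c * ?d) * (b * d) = (d * ?d) * (c * b)" by simp
  also have "[(b * ?b) * (a * d) = (d * ?d) * (c * b)] (mod int p) \<longleftrightarrow> [a * d = c * b] (mod int p)"
    using cong_scalar_right[OF b, of "a * d"] cong_scalar_right[OF d, of "c * b"]
    by (metis (no_types, lifting) cong_def mult_1)
  finally show ?thesis .
qed

end

theory Submission
  imports Defs
begin

text \<open>The binomial transform \<open>f \<mapsto> (\<lambda>n. \<Sum>k\<le>n. (-1)^k (n choose k) f k)\<close> maps the summatory function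
  \<^term>\<open>S I\<close> to minus the difference sequence of \<^term>\<open>S (dual_comp I)\<close>. This follows by induction on
  the weight: multiplying differences by \<open>n\<close>, i.e.\ lowering the first part of \<open>I\<close> or deleting it when
  it is 1, corresponds on the dual side to deleting a first part 1 or lowering the first part.
  Summing gives \<open>S (dual_comp I) n = - (\<Sum>k\<le>n. (-1)^k (n+1 choose k+1) S I k)\<close>, and for \<open>n = p - 1\<close>
  all binomial coefficients except the last are divisible by \<open>p\<close>.\<close>

section \<open>The binomial transform\<close>

text \<open>With \<open>E\<close> the shift operator, this is \<open>(1 - E)^n f\<close> evaluated
  at 0.\<close>

definition binomial_transform :: "(nat \<Rightarrow> 'a::comm_ring_1) \<Rightarrow> nat \<Rightarrow> 'a" where
  "binomial_transform f n = (\<Sum>k\<le>n. (-1) ^ k * of_nat (n choose k) * f k)"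

lemma binomial_transform_0 [simp]: "binomial_transform f 0 = f 0"
  by (simp add: binomial_transform_def)

text \<open>Pascal's rule; as operators,
  \<open>(1 - E)^(n+1) = (1 - E)^n - (1 - E)^n E\<close>.\<close>

lemma binomial_transform_Suc:
  "binomial_transform f (Suc n) = binomial_transform f n - binomial_transform (\<lambda>k. f (Suc k)) n"
proof -
  have "binomial_transform f (Suc n) =
      f 0 + (\<Sum>k\<le>n. (-1) ^ Suc k * of_nat (Suc n choose Suc k) * f (Suc k))"
    unfolding binomial_transform_def by (subst sum.atMost_Suc_shift) simp
  also have "\<dots> = (f 0 + (\<Sum>k\<le>n. (-1) ^ Suc k * of_nat (n choose Suc k) * f (Suc k)))
      - binomial_transform (\<lambda>k. f (Suc k)) n"
    by (simp add: binomial_transform_def algebra_simps sum.distrib sum_negf sum_subtractf)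
  also have "f 0 + (\<Sum>k\<le>n. (-1) ^ Suc k * of_nat (n choose Suc k) * f (Suc k)) =
      (\<Sum>k\<le>Suc n. (-1) ^ k * of_nat (n choose k) * f k)"
    by (subst sum.atMost_Suc_shift) simp
  also have "\<dots> = binomial_transform f n"
    by (simp add: binomial_transform_def binomial_eq_0)
  finally show ?thesis .
qed

lemma binomial_transform_sums:
  assumes "\<And>k. F (Suc k) = F k + f (Suc k)"
  shows "binomial_transform F (Suc n) = - binomial_transform (\<lambda>k. f (Suc k)) n"
  unfolding binomial_transform_Suc
  by (simp add: assms binomial_transform_def algebra_simps sum.distrib)

text \<open>Summation turns into differencing. The value \<open>f 0\<close> is arbitrary because it
  cancels on the right.\<close>

lemma binomial_transform_sums_diff:
  assumes "\<And>k. F (Suc k) = F k + f (Suc k)"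
  shows "binomial_transform F (Suc n) = binomial_transform f (Suc n) - binomial_transform f n"
  using binomial_transform_sums[of F f n] assms by (simp add: binomial_transform_Suc)

text \<open>The absorption identity moves the factor \<open>k\<close> out of the sum as
  \<open>Suc n\<close>; the term \<open>k = 0\<close> vanishes.\<close>

lemma binomial_transform_times_index:
  "binomial_transform (\<lambda>k. of_nat k * f k) (Suc n) =
     - (of_nat (Suc n) * binomial_transform (\<lambda>k. f (Suc k)) n)"
proof -
  have absorb: "of_nat (Suc n choose Suc k) * of_nat (Suc k) = (of_nat (Suc n) * of_nat (n choose k) :: 'a)" for k
    by (metis Suc_times_binomial_eq of_nat_mult)
  have "binomial_transform (\<lambda>k. of_nat k * f k) (Suc n) =
      (\<Sum>k\<le>n. (-1) ^ Suc k * (of_nat (Suc n choose Suc k) * of_nat (Suc k)) * f (Suc k))"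
    unfolding binomial_transform_def
    by (subst sum.atMost_Suc_shift) (simp add: mult.assoc del: of_nat_Suc binomial_Suc_Suc)
  also have "\<dots> = - (of_nat (Suc n) * binomial_transform (\<lambda>k. f (Suc k)) n)"
    unfolding absorb binomial_transform_def sum_distrib_left sum_negf[symmetric]
    by (simp add: mult_ac del: of_nat_Suc)
  finally show ?thesis .
qed

text \<open>Both sides equal \<open>- Suc n\<close> times the transform of the shifted
  \<open>f\<close>. The second hypothesis forces \<open>g 0 = 0\<close>, which each application has
  to secure.\<close>

lemma binomial_transform_sums_times:
  assumes "\<And>k. F (Suc k) = F k + f (Suc k)" and "\<And>k. of_nat k * f k = g k"
  shows "of_nat (Suc n) * binomial_transform F (Suc n) = binomial_transform g (Suc n)"
  using binomial_transform_times_index[of f n] assms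
  by (simp add: binomial_transform_sums[of F f] del: of_nat_Suc)

text \<open>Hockey-stick summation of the coefficients \<open>m choose k\<close> over
  \<open>m\<close>, done through Pascal's rule.\<close>

lemma sum_binomial_transform:
  "(\<Sum>m\<le>n. binomial_transform f m) = (\<Sum>k\<le>n. (-1) ^ k * of_nat (Suc n choose Suc k) * f k)"
proof (induction n)
  case (Suc n)
  have "(\<Sum>k\<le>Suc n. (-1) ^ k * of_nat (Suc (Suc n) choose Suc k) * f k) =
      (\<Sum>k\<le>Suc n. (-1) ^ k * of_nat (Suc n choose k) * f k) +
      (\<Sum>k\<le>Suc n. (-1) ^ k * of_nat (Suc n choose Suc k) * f k)"
    unfolding binomial_Suc_Suc[of "Suc n"]
    by (simp only: of_nat_add distrib_left distrib_right sum.distrib)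
  also have "(\<Sum>k\<le>Suc n. (-1) ^ k * of_nat (Suc n choose Suc k) * f k) =
      (\<Sum>k\<le>n. (-1) ^ k * of_nat (Suc n choose Suc k) * f k)"
    by (simp add: binomial_eq_0)
  finally show ?case
    using Suc by (simp add: binomial_transform_def[of f "Suc n"] del: binomial_Suc_Suc)
qed simp

section \<open>Nested harmonic sums\<close>

lemma S_Nil: "S [] n = 1"
proof -
  have "{ns::nat list. length ns = length ([]::nat list) \<and> set ns \<subseteq> {1..n} \<and> sorted_wrt (\<ge>) ns} = {[]}"
    by auto
  then show ?thesis by (simp add: S_def)
qed

text \<open>Splits off the largest entry \<open>m\<close>; the remaining entries form an admissible
  tuple bounded by \<open>m\<close>.\<close>

lemma S_Cons: "S (i # I) n = (\<Sum>m=1..n. S I m / of_nat m ^ i)"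
proof -
  define A where "A m = {ns. length ns = length I \<and> set ns \<subseteq> {1..m} \<and> sorted_wrt (\<ge>) ns}" for m :: nat
  have fin: "finite (A m)" for m
    unfolding A_def by (rule finite_S_index)
  have idx: "{ns. length ns = length (i # I) \<and> set ns \<subseteq> {1..n} \<and> sorted_wrt (\<ge>) ns} =
      (\<lambda>(m, ns). m # ns) ` (SIGMA m:{1..n}. A m)" (is "?L = ?R")
  proof
    show "?L \<subseteq> ?R"
    proof
      fix ns assume "ns \<in> ?L"
      then show "ns \<in> ?R"
        by (cases ns) (auto simp: A_def image_iff subset_iff)
    qed
    show "?R \<subseteq> ?L" by (force simp: A_def subset_iff)
  qed
  have inj: "inj_on (\<lambda>(m, ns). m # ns) (SIGMA m:{1..n}. A m)"
    by (auto simp: inj_on_def)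
  have "S (i # I) n = (\<Sum>(m, ns)\<in>(SIGMA m:{1..n}. A m).
      1 / (of_nat m ^ i * (\<Prod>j<length I. of_nat (ns ! j) ^ (I ! j))))"
    unfolding S_def idx sum.reindex[OF inj]
    by (auto intro!: sum.cong simp: prod.lessThan_Suc_shift simp del: prod.lessThan_Suc)
  also have "\<dots> = (\<Sum>m=1..n. \<Sum>ns\<in>A m. 1 / (of_nat m ^ i * (\<Prod>j<length I. of_nat (ns ! j) ^ (I ! j))))"
    using fin by (simp add: sum.Sigma)
  also have "\<dots> = (\<Sum>m=1..n. S I m / of_nat m ^ i)"
    by (simp add: S_def A_def sum_divide_distrib mult.commute)
  finally show ?thesis .
qed

lemma S_0: "I \<noteq> [] \<Longrightarrow> S I 0 = 0"
  by (cases I) (auto simp: S_Cons)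

lemma S_Cons_Suc: "S (i # I) (Suc n) = S (i # I) n + S I (Suc n) / of_nat (Suc n) ^ i"
  by (simp add: S_Cons)

section \<open>Duality of compositions\<close>

text \<open>Prepending 1 and raising the first part generate all compositions from
  \<open>[1]\<close>; these are the two moves that duality exchanges.\<close>

lemma composition_induct [consumes 1, case_names one Cons_one Suc]:
  assumes "composition I"
    and "P [1]"
    and "\<And>I. composition I \<Longrightarrow> P I \<Longrightarrow> P (1 # I)"
    and "\<And>i I. composition (i # I) \<Longrightarrow> P (i # I) \<Longrightarrow> P (Suc i # I)"
  shows "P I"
  using assms(1)
proof (induction I)
  case (Cons i I)
  have "0 < i" and I: "I = [] \<or> composition I"
    using Cons.prems by (auto simp: composition_Cons)
  have base: "P (1 # I)"
    using I Cons.IH assms(2,3) by auto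
  from \<open>0 < i\<close> show ?case
  proof (induction i rule: nat_induct_non_zero)
    case (Suc i)
    then show ?case using assms(4)[of i I] I by (auto simp: composition_Cons)
  qed (use base in simp)
qed (simp add: composition_def)

lemma
  assumes "composition I"
  shows composition_dual_comp: "composition (dual_comp I)"
    and weight_dual_comp: "weight (dual_comp I) = weight I"
    and subset_of_dual_comp: "subset_of_comp (dual_comp I) = {1..<weight I} - subset_of_comp I"
  using theI'[OF dual_comp_ex1[OF assms]] by (auto simp: dual_comp_def)

lemma subset_of_comp_Suc: "subset_of_comp (Suc i # I) = Suc ` subset_of_comp (i # I)"
  by (auto simp: subset_of_comp_Cons image_image)

lemma subset_of_comp_Cons_one:
  "composition I \<Longrightarrow> subset_of_comp (1 # I) = insert 1 (Suc ` subset_of_comp I)"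
  by (auto simp: subset_of_comp_Cons composition_def)

lemma Suc_image_Diff:
  "Suc ` ({1..<w} - A) = {1..<Suc w} - insert 1 (Suc ` A)"
  by (simp add: image_set_diff image_Suc_atLeastLessThan) auto

lemma dual_comp_one: "dual_comp [1] = [1]"
  by (rule dual_comp_eqI) (auto simp: composition_def weight_def subset_of_comp_Cons)

text \<open>Either move shifts the associated subset by 1, and prepending 1 also inserts 1. Exactly
  one of two complementary subsets contains 1, so complementation swaps the moves.\<close>

lemma dual_comp_Cons_one:
  assumes "composition I" "dual_comp I = j # J"
  shows "dual_comp (1 # I) = Suc j # J"
proof (rule dual_comp_eqI)
  show "composition (Suc j # J)"
    using composition_dual_comp[OF assms(1)] assms(2) by (simp add: composition_Cons)
  show "weight (Suc j # J) = weight (1 # I)"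
    using weight_dual_comp[OF assms(1)] assms(2) by (simp add: weight_def)
  have "subset_of_comp (Suc j # J) = Suc ` ({1..<weight I} - subset_of_comp I)"
    using subset_of_dual_comp[OF assms(1)] assms(2) by (simp add: subset_of_comp_Suc)
  then show "subset_of_comp (Suc j # J) = {1..<weight (1 # I)} - subset_of_comp (1 # I)"
    unfolding subset_of_comp_Cons_one[OF assms(1)] Suc_image_Diff by (simp add: weight_def)
qed (use assms(1) in \<open>simp add: composition_Cons\<close>)

lemma dual_comp_Suc:
  assumes "composition (i # I)"
  shows "dual_comp (Suc i # I) = 1 # dual_comp (i # I)"
proof (rule dual_comp_eqI)
  let ?w = "weight (i # I)" and ?A = "subset_of_comp (i # I)"
  show "composition (Suc i # I)" using assms by (simp add: composition_Cons)
  show "composition (1 # dual_comp (i # I))"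
    using composition_dual_comp[OF assms] by (simp add: composition_Cons)
  show "weight (1 # dual_comp (i # I)) = weight (Suc i # I)"
    using weight_dual_comp[OF assms] by (simp add: weight_def)
  \<comment> \<open>\<open>?A\<close> misses 0, so its shift misses 1; positive weight puts 1 into
    \<open>{1..<Suc ?w}\<close>, hence into the complement.\<close>
  have "1 \<notin> Suc ` ?A" "0 < ?w"
    using subset_of_comp_subset[OF assms] weight_pos[OF assms] by auto
  then have "insert 1 (Suc ` ({1..<?w} - ?A)) = {1..<Suc ?w} - Suc ` ?A"
    unfolding Suc_image_Diff by auto
  then show "subset_of_comp (1 # dual_comp (i # I)) =
      {1..<weight (Suc i # I)} - subset_of_comp (Suc i # I)"
    unfolding subset_of_comp_Cons_one[OF composition_dual_comp[OF assms]]
      subset_of_dual_comp[OF assms] subset_of_comp_Suc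
    by (simp add: weight_def)
qed

section \<open>Duality of nested sums under the binomial transform\<close>

theorem binomial_transform_S:
  assumes "composition I"
  shows "binomial_transform (S I) (Suc n) = S (dual_comp I) n - S (dual_comp I) (Suc n)"
  using assms
proof (induction I arbitrary: n rule: composition_induct)
  case one
  \<comment> \<open>Since \<open>0 * (1 / 0) = 0\<close>, multiplying by the index gives the
    constant 1 with its value at 0 removed. The constant has transform 0 at \<open>Suc n\<close>,
    and the missing term leaves -1.\<close>
  have *: "binomial_transform (\<lambda>k. if k = 0 then 0 else 1) (Suc n) = (-1 :: rat)" for n
    using choose_alternating_sum[of "Suc n", where 'a = rat]
    unfolding binomial_transform_def sum.atMost_Suc_shift
    by (simp add: eq_neg_iff_add_eq_0 add.commute del: binomial_Suc_Suc)
  have "of_nat (Suc n) * binomial_transform (S [1]) (Suc n) = -1"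
    unfolding *[of n, symmetric]
    by (rule binomial_transform_sums_times[where f = "\<lambda>k. S [] k / of_nat k"])
      (auto simp: S_Cons_Suc S_Nil)
  then have "binomial_transform (S [1]) (Suc n) = - (1 / of_nat (Suc n))"
    by (simp add: field_simps)
  then show ?case
    unfolding dual_comp_one by (simp add: S_Cons_Suc S_Nil)
next
  case (Cons_one I)
  obtain j J where J: "dual_comp I = j # J"
    using composition_dual_comp[OF Cons_one.hyps] by (cases "dual_comp I") (auto simp: composition_def)
  have "I \<noteq> []" using Cons_one.hyps by (simp add: composition_def)
  \<comment> \<open>\<open>S I 0 = 0\<close> makes \<open>k * (S I k / k) = S I k\<close> hold at
    \<open>k = 0\<close> too.\<close>
  then have "of_nat (Suc n) * binomial_transform (S (1 # I)) (Suc n) = binomial_transform (S I) (Suc n)"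
    by (intro binomial_transform_sums_times[where f = "\<lambda>k. S I k / of_nat k"])
      (auto simp: S_Cons_Suc S_0)
  \<comment> \<open>The induction hypothesis leaves only the last summand of
    \<open>S (j # J)\<close>; dividing by \<open>Suc n\<close> then raises \<open>j\<close> by
    one.\<close>
  also have "\<dots> = - (S J (Suc n) / of_nat (Suc n) ^ j)"
    unfolding Cons_one.IH J by (simp add: S_Cons_Suc)
  finally have "binomial_transform (S (1 # I)) (Suc n) =
      - (S J (Suc n) / of_nat (Suc n) ^ j) / of_nat (Suc n)"
    by (subst eq_divide_eq) (simp add: mult.commute del: of_nat_Suc)
  then have "binomial_transform (S (1 # I)) (Suc n) = - (S J (Suc n) / of_nat (Suc n) ^ Suc j)"
    by (simp add: mult.commute del: of_nat_Suc)
  then show ?case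
    unfolding dual_comp_Cons_one[OF Cons_one.hyps J] by (simp add: S_Cons_Suc)
next
  case (Suc i I)
  define J where "J = dual_comp (i # I)"
  define g where "g k = S I k / of_nat k ^ i" for k
  note IH = Suc.IH[folded J_def]
  have "0 < i" using Suc.hyps by (simp add: composition_Cons)
  have "J \<noteq> []"
    using composition_dual_comp[OF Suc.hyps] by (auto simp: J_def composition_def)
  \<comment> \<open>\<open>g\<close> is the summand of \<open>S (i # I)\<close>, so by the induction
    hypothesis its transform has the same differences as \<open>- S J\<close>. Both start at 0:
    \<open>g 0 = 0\<close> because \<open>0 < i\<close> makes it a division by zero.\<close>
  have g: "binomial_transform g m = - S J m" for m
  proof (induction m)
    case 0
    then show ?case using \<open>0 < i\<close> S_0[OF \<open>J \<noteq> []\<close>] by (simp add: g_def)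
  next
    case (Suc m)
    have "S J m - S J (Suc m) = binomial_transform g (Suc m) - binomial_transform g m"
      unfolding IH[symmetric] by (rule binomial_transform_sums_diff) (simp add: S_Cons_Suc g_def)
    with Suc show ?case by simp
  qed
  have "of_nat (Suc n) * binomial_transform (S (Suc i # I)) (Suc n) = binomial_transform g (Suc n)"
    using \<open>0 < i\<close>
    by (intro binomial_transform_sums_times[where f = "\<lambda>k. S I k / of_nat k ^ Suc i"])
      (auto simp: S_Cons_Suc g_def)
  then have "binomial_transform (S (Suc i # I)) (Suc n) = - (S J (Suc n) / of_nat (Suc n))"
    unfolding g by (simp add: field_simps)
  then show ?case
    unfolding dual_comp_Suc[OF Suc.hyps] J_def[symmetric] by (simp add: S_Cons_Suc)
qed

theorem S_dual_comp:
  assumes "composition I"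
  shows "S (dual_comp I) n = - (\<Sum>k\<le>n. (-1) ^ k * of_nat (Suc n choose Suc k) * S I k)"
proof -
  have "I \<noteq> []" "dual_comp I \<noteq> []"
    using assms composition_dual_comp[OF assms] by (auto simp: composition_def)
  \<comment> \<open>Telescoping; at index 0 both \<open>S (dual_comp I)\<close> and the transform
    vanish.\<close>
  then have "S (dual_comp I) n = - (\<Sum>m\<le>n. binomial_transform (S I) m)"
    by (induction n) (auto simp: S_0 binomial_transform_S[OF assms])
  then show ?thesis by (simp only: sum_binomial_transform)
qed

section \<open>Rationals integral at a prime\<close>

text \<open>The reduced denominator divides every other denominator, so any fraction can serve as a
  witness. Closure under ring operations then needs no reduction to lowest terms.\<close>

lemma rat_integral_at_iff:
  "rat_integral_at p x \<longleftrightarrow> (\<exists>a b. coprime b (int p) \<and> b \<noteq> 0 \<and> x = of_int a / of_int b)"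
proof
  assume "rat_integral_at p x"
  moreover have "x = of_int (fst (quotient_of x)) / of_int (snd (quotient_of x))"
    by (rule quotient_of_div) simp
  moreover have "snd (quotient_of x) \<noteq> 0"
    using quotient_of_denom_pos'[of x] by simp
  ultimately show "\<exists>a b. coprime b (int p) \<and> b \<noteq> 0 \<and> x = of_int a / of_int b"
    unfolding rat_integral_at_def by blast
next
  assume "\<exists>a b. coprime b (int p) \<and> b \<noteq> 0 \<and> x = of_int a / of_int b"
  then obtain a b where ab: "coprime b (int p)" "b \<noteq> 0" "x = of_int a / of_int b" by blast
  obtain c d where cd: "quotient_of x = (c, d)" by force
  have x: "x = of_int c / of_int d" "coprime c d" "d > 0"
    using quotient_of_div[OF cd] quotient_of_coprime[OF cd] quotient_of_denom_pos[OF cd] by auto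
  have "(of_int (a * d) :: rat) = of_int (c * b)"
    using ab x by (simp add: field_simps)
  then have "d dvd c * b" by (metis of_int_eq_iff dvd_triv_right)
  then have "d dvd b" using x(2) coprime_dvd_mult_right_iff[of d c b] by (simp add: coprime_commute)
  then show "rat_integral_at p x"
    unfolding rat_integral_at_def cd using coprime_divisors[OF _ dvd_refl ab(1)] by simp
qed

lemma rat_integral_at_of_int: "rat_integral_at p (of_int a)"
  unfolding rat_integral_at_iff by (intro exI[of _ a] exI[of _ 1]) auto

lemma rat_integral_at_mult:
  assumes "rat_integral_at p x" "rat_integral_at p y"
  shows "rat_integral_at p (x * y)"
proof -
  obtain a b c d where "coprime b (int p)" "b \<noteq> 0" "x = of_int a / of_int b"
    "coprime d (int p)" "d \<noteq> 0" "y = of_int c / of_int d"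
    using assms unfolding rat_integral_at_iff by blast
  then show ?thesis unfolding rat_integral_at_iff
    by (intro exI[of _ "a * c"] exI[of _ "b * d"]) auto
qed

lemma rat_integral_at_add:
  assumes "rat_integral_at p x" "rat_integral_at p y"
  shows "rat_integral_at p (x + y)"
proof -
  obtain a b c d where "coprime b (int p)" "b \<noteq> 0" "x = of_int a / of_int b"
    "coprime d (int p)" "d \<noteq> 0" "y = of_int c / of_int d"
    using assms unfolding rat_integral_at_iff by blast
  then show ?thesis unfolding rat_integral_at_iff
    by (intro exI[of _ "a * d + c * b"] exI[of _ "b * d"]) (auto simp: field_simps)
qed

lemma rat_integral_at_minus: "rat_integral_at p x \<Longrightarrow> rat_integral_at p (- x)"
  using rat_integral_at_mult[OF rat_integral_at_of_int[of p "-1"]] by simp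

lemma rat_integral_at_sum:
  "(\<And>k. k \<in> A \<Longrightarrow> rat_integral_at p (f k)) \<Longrightarrow> rat_integral_at p (sum f A)"
  using rat_integral_at_of_int[of p 0]
  by (induction A rule: infinite_finite_induct) (auto intro: rat_integral_at_add)

lemma rat_integral_at_divide_power:
  assumes "prime p" "0 < m" "m < p" "rat_integral_at p x"
  shows "rat_integral_at p (x / of_nat m ^ i)"
proof -
  have "coprime (int m) (int p)"
    using assms prime_nat_not_dvd[of p m]
    by (metis coprime_commute coprime_int_iff nat_dvd_not_less prime_imp_coprime)
  then have "rat_integral_at p (1 / of_nat m ^ i)"
    unfolding rat_integral_at_iff using assms
    by (intro exI[of _ 1] exI[of _ "int m ^ i"]) auto
  from rat_integral_at_mult[OF assms(4) this] show ?thesis by simp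
qed

text \<open>All summation indices are positive and below \<open>p\<close>, so only units at
  \<open>p\<close> occur as denominators.\<close>

lemma rat_integral_at_S:
  assumes "prime p" "n < p"
  shows "rat_integral_at p (S I n)"
  using assms(2)
proof (induction I arbitrary: n)
  case Nil
  then show ?case using rat_integral_at_of_int[of p 1] by (simp add: S_Nil)
next
  case (Cons i I)
  then show ?case unfolding S_Cons
    by (intro rat_integral_at_sum rat_integral_at_divide_power) (auto simp: assms(1))
qed

text \<open>Replaces residues by divisibility: after clearing denominators, \<open>f\<close> is
  cancelled because it is prime to \<open>p\<close>.\<close>

lemma rat_cong_diffI:
  assumes "rat_integral_at p x" "rat_integral_at p y" "rat_integral_at p z" "x - y = of_nat p * z"
  shows "rat_cong x y p"
proof -
  obtain a b c d where q: "quotient_of x = (a, b)" "quotient_of y = (c, d)" by (meson surj_pair)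
  obtain e f where z: "coprime f (int p)" "f \<noteq> 0" "z = of_int e / of_int f"
    using assms(3) unfolding rat_integral_at_iff by blast
  have xy: "x = of_int a / of_int b" "y = of_int c / of_int d" "b > 0" "d > 0"
    using quotient_of_div quotient_of_denom_pos q by blast+
  have "(of_int ((a * d - c * b) * f) :: rat) = of_int (int p * (e * b * d))"
    using assms(4) z(2) xy unfolding xy(1,2) z(3) by (simp add: field_simps)
  then have "int p dvd (a * d - c * b) * f" by (metis of_int_eq_iff dvd_triv_left)
  then have "int p dvd a * d - c * b"
    using z(1) coprime_dvd_mult_left_iff[of "int p" f] by (simp add: coprime_commute)
  then show ?thesis
    unfolding rat_cong_iff[OF assms(1,2) q] by (simp add: cong_iff_dvd_diff)
qed

section \<open>The congruence modulo \<open>p\<close>\<close>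

theorem theorem6p7:
  fixes I :: "nat list" and p :: nat
  assumes "composition I" and "prime p"
  shows "rat_cong (S I (p - 1)) (- S (dual_comp I) (p - 1)) p"
proof -
  obtain n where p: "p = Suc n" using prime_gt_0_nat[OF assms(2)] by (cases p) auto
  define q where "q k = (p choose Suc k) div p" for k
  have q: "p choose Suc k = p * q k" if "k < n" for k
  proof -
    have "p dvd p choose Suc k"
      by (rule dvd_choose_prime) (use assms(2) that p in auto)
    then show ?thesis by (simp only: q_def dvd_mult_div_cancel)
  qed
  \<comment> \<open>\<open>p * z\<close> collects the terms \<open>k < n\<close> of
    \<open>S_dual_comp\<close>, whose coefficients are divisible by \<open>p\<close>; the term
    \<open>k = n\<close> has binomial coefficient 1 and stays separate.\<close>
  define z where "z = - (\<Sum>k<n. (-1) ^ k * of_nat (q k) * S I k)"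
  have z: "rat_integral_at p z"
    unfolding z_def
  proof (intro rat_integral_at_minus rat_integral_at_sum rat_integral_at_mult[OF _ rat_integral_at_S])
    show "rat_integral_at p ((-1) ^ k * of_nat (q k))" for k
      using rat_integral_at_of_int[of p "(-1) ^ k * int (q k)"] by simp
  qed (use assms p in auto)
  have dual: "S (dual_comp I) n = of_nat p * z - (-1) ^ n * S I n"
  proof -
    have "(\<Sum>k<n. (-1) ^ k * of_nat (Suc n choose Suc k) * S I k) =
        (\<Sum>k<n. of_nat p * ((-1) ^ k * of_nat (q k) * S I k))"
      using q unfolding p[symmetric] by (intro sum.cong) (auto simp: mult_ac)
    then show ?thesis
      unfolding S_dual_comp[OF assms(1)] z_def lessThan_Suc_atMost[symmetric] sum.lessThan_Suc
      by (simp add: sum_distrib_left del: binomial_Suc_Suc)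
  qed
  have S: "rat_integral_at p (S J n)" for J
    using assms(2) p by (intro rat_integral_at_S) auto
  \<comment> \<open>For odd \<open>p\<close> the sign \<open>(-1) ^ n\<close> is 1 and the copies of
    \<open>S I n\<close> cancel. For \<open>p = 2\<close> they add up to \<open>2 * S I n\<close>,
    itself a multiple of \<open>p\<close>.\<close>
  have "\<exists>w. rat_integral_at p w \<and> S I n + S (dual_comp I) n = of_nat p * w"
  proof (cases "p = 2")
    case True
    then show ?thesis unfolding dual using p rat_integral_at_add[OF z S[of I]]
      by (intro exI[of _ "z + S I n"]) (simp add: algebra_simps)
  next
    case False
    then have "even n"
      using primes_dvd_imp_eq[of 2 p] assms(2) p by auto
    then show ?thesis unfolding dual using z by auto
  qed
  then obtain w where "rat_integral_at p w" "S I n + S (dual_comp I) n = of_nat p * w" by blast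
  then show ?thesis
    using rat_cong_diffI[of p "S I n" "- S (dual_comp I) n" w] S rat_integral_at_minus p by simp
qed

end
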